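(* Let $d\ge 1$ and let $S\subseteq (0,1)^d$ be arbitrary. Then there is a residual subset $\mathcal{F}$ of $\operatorname{Lip}_1([0,1]^d,\mathbb{R})$ such that for every $f\in\mathcal{F}$ the set of non-differentiability points of $f$ in $S$ is residual in $S$.
   Context: $\mathbb{R}^d$ carries the Euclidean norm. $\operatorname{Lip}_1([0,1]^d,\mathbb{R})$ is the set of all Lipschitz functions $f:[0,1]^d\to\mathbb{R}$ with Lipschitz constant at most $1$, equipped with the (complete) metric $\rho(f,g)=\sup\{|f(x)-g(x)| : x\in[0,1]^d\}$. A subset of a topological space is residual if its complement is of first Baire category (meagre) in that space; "residual in $S$" means residual in $S$ with the subspace topology inherited from $\mathbb{R}^d$. *)

theory Defs
  imports "HOL-Analysis.Analysis"
begin

definition nowhere_dense_in :: "'a topology \<Rightarrow> 'a set \<Rightarrow> bool" where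
  "nowhere_dense_in X A \<longleftrightarrow> A \<subseteq> topspace X \<and> X interior_of (X closure_of A) = {}"

definition meagre_in :: "'a topology \<Rightarrow> 'a set \<Rightarrow> bool" where
  "meagre_in X A \<longleftrightarrow> (\<exists>\<N>. countable \<N> \<and> (\<forall>N\<in>\<N>. nowhere_dense_in X N) \<and> A = \<Union>\<N>)"

definition residual_in :: "'a topology \<Rightarrow> 'a set \<Rightarrow> bool" where
  "residual_in X A \<longleftrightarrow> A \<subseteq> topspace X \<and> meagre_in X (topspace X - A)"

text \<open>
  Functions on the cube $[0,1]^d$ are represented by total functions that are
  \<^const>\<open>extensional\<close> on \<^term>\<open>cbox 0 1\<close>; \<^const>\<open>funspace\<close> consists of the bounded ones
  and carries the supremum metric. (In \<^typ>\<open>real^'n\<close>, \<^term>\<open>1\<close> is the all-ones vector.)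
  The lemmas below confirm that boundedness is not an extra restriction and that the
  distance is the expected one.
\<close>

definition Lip1 :: "(real^'n \<Rightarrow> real) metric" where
  "Lip1 = submetric (funspace (cbox 0 1) euclidean_metric) {f. 1-lipschitz_on (cbox 0 1) f}"

lemma mspace_Lip1:
  "mspace (Lip1 :: (real^'n \<Rightarrow> real) metric) =
     {f. f \<in> extensional (cbox 0 1) \<and> 1-lipschitz_on (cbox 0 1) f}"
proof -
  have "bounded (f ` cbox 0 1)" if "1-lipschitz_on (cbox 0 1) f" for f :: "real^'n \<Rightarrow> real"
    using that by (intro compact_imp_bounded compact_continuous_image
        lipschitz_on_continuous_on compact_cbox)
  then show ?thesis
    by (auto simp: Lip1_def Met_TC.fspace_def)
qed

lemma mdist_Lip1:
  fixes f g :: "real^'n \<Rightarrow> real"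
  assumes "f \<in> mspace Lip1" "g \<in> mspace Lip1"
  shows "mdist Lip1 f g = (SUP x\<in>cbox 0 1. \<bar>f x - g x\<bar>)"
proof -
  have "cbox 0 (1::real^'n) \<noteq> {}"
    by (auto simp: interval_ne_empty_cart)
  with assms show ?thesis
    by (auto simp: Lip1_def Met_TC.fdist_def dist_real_def)
qed

end

theory Submission
  imports Defs
begin

text \<open>
  A function that is differentiable at \<open>x\<close> satisfies
  \<open>f (x + r e) + f (x - r e) - 2 f x = o(r)\<close> for a unit vector \<open>e\<close>. Hence \<open>f\<close> fails to be
  differentiable at \<open>x\<close> as soon as this second difference is below \<open>-r\<close> for arbitrarily small
  \<open>r\<close>. Let \<open>K n f\<close> be the set of the points \<open>x\<close> of the open cube at which this happens for some
  \<open>r < 1 / (n + 1)\<close> (the set \<open>kinks\<close> below). Only three values of \<open>f\<close> enter, and the inequality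
  is strict, so the condition \<open>x \<in> K n f\<close> is open in \<open>x\<close> for fixed \<open>f\<close> and open in \<open>f\<close> for
  fixed \<open>x\<close>.

  It is also dense in \<open>f\<close>: the downward cone \<open>f q - norm (x - q)\<close> lies below every \<open>1\<close>-Lipschitz
  \<open>f\<close>, so the \<open>1\<close>-Lipschitz function \<open>max (f x - \<delta>) (f q - norm (x - q))\<close> lies between
  \<open>f - \<delta>\<close> and \<open>f\<close>, while near \<open>q\<close> it agrees with the cone, whose second difference
  at \<open>q\<close> is \<open>-2 r\<close> (lemma \<open>kinks_dense\<close>).

  Now let \<open>D\<close> be a countable dense subset of \<open>S\<close>, and let \<open>\<F>\<close> consist of the \<open>f\<close> with
  \<open>D \<subseteq> K n f\<close> for all \<open>n\<close>. As a countable intersection of open dense sets, \<open>\<F>\<close> is residual.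
  For \<open>f \<in> \<F>\<close> each \<open>S \<inter> K n f\<close> is open in \<open>S\<close> and dense in \<open>S\<close>, because it contains \<open>D\<close>; so
  the set of points of \<open>S\<close> that lie in all \<open>K n f\<close>, at which \<open>f\<close> is not differentiable,
  is residual in \<open>S\<close>.
\<close>

lemma residual_in_if_contains_Inter_open_dense:
  fixes U :: "'i \<Rightarrow> 'a set"
  assumes "countable I"
    and op: "\<And>i. i \<in> I \<Longrightarrow> openin X (U i)"
    and dense: "\<And>i. i \<in> I \<Longrightarrow> X closure_of (U i) = topspace X"
    and sub: "A \<subseteq> topspace X"
    and sup: "\<And>x. x \<in> topspace X \<Longrightarrow> (\<And>i. i \<in> I \<Longrightarrow> x \<in> U i) \<Longrightarrow> x \<in> A"
  shows "residual_in X A"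
proof -
  let ?N = "\<lambda>i. (topspace X - A) - U i"
  have "nowhere_dense_in X (?N i)" if "i \<in> I" for i
  proof -
    have "closedin X (topspace X - U i)"
      using op[OF that] by blast
    then have "X closure_of (?N i) \<subseteq> topspace X - U i"
      by (intro closure_of_minimal) auto
    moreover have "X interior_of (topspace X - U i) = {}"
      by (simp add: interior_of_complement dense[OF that])
    ultimately have "X interior_of (X closure_of (?N i)) = {}"
      using interior_of_mono by (metis subset_empty)
    then show ?thesis
      unfolding nowhere_dense_in_def by blast
  qed
  moreover have "topspace X - A = \<Union>(?N ` I)"
    using sup by blast
  ultimately have "meagre_in X (topspace X - A)"
    unfolding meagre_in_def using \<open>countable I\<close> by (intro exI[of _ "?N ` I"]) blast
  with sub show ?thesis
    unfolding residual_in_def by blast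
qed

definition second_difference :: "('a::real_vector \<Rightarrow> real) \<Rightarrow> 'a \<Rightarrow> 'a \<Rightarrow> real" where
  "second_difference f v x = f (x + v) + f (x - v) - 2 * f x"

text \<open>
  All three points are kept in the \<^emph>\<open>open\<close> cube, where a Lipschitz function on the closed cube is
  continuous and its derivative does not see the values outside the closed cube.
\<close>

definition kinks :: "real^'n \<Rightarrow> nat \<Rightarrow> (real^'n \<Rightarrow> real) \<Rightarrow> (real^'n) set" where
  "kinks e n f = {x \<in> box 0 1. \<exists>r. 0 < r \<and> r < inverse (real (Suc n)) \<and>
     x + r *\<^sub>R e \<in> box 0 1 \<and> x - r *\<^sub>R e \<in> box 0 1 \<and> second_difference f (r *\<^sub>R e) x < - r}"

lemma not_differentiable_if_kinks:
  fixes f :: "real^'n \<Rightarrow> real"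
  assumes "norm e = 1" and kinks: "\<And>n. x \<in> kinks e n f"
  shows "\<not> f differentiable (at x)"
proof
  assume "f differentiable (at x)"
  then obtain f' where f': "(f has_derivative f') (at x)"
    unfolding differentiable_def by blast
  then interpret f': bounded_linear f'
    by (rule has_derivative_bounded_linear)
  obtain d where "d > 0" and
    d: "\<And>y. norm (y - x) < d \<Longrightarrow> norm (f y - f x - f' (y - x)) \<le> 1/4 * norm (y - x)"
    using f' unfolding has_derivative_at_alt
    by (meson zero_less_divide_1_iff zero_less_numeral)
  obtain n where n: "inverse (real (Suc n)) < d"
    using reals_Archimedean[OF \<open>d > 0\<close>] by blast
  obtain r where r: "0 < r" "r < inverse (real (Suc n))"
      "second_difference f (r *\<^sub>R e) x < - r"
    using kinks[of n] unfolding kinks_def by blast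
  have norm: "norm (r *\<^sub>R e) = r"
    using \<open>norm e = 1\<close> r by simp
  have "norm (f (x + r *\<^sub>R e) - f x - f' (r *\<^sub>R e)) \<le> 1/4 * r"
    using d[of "x + r *\<^sub>R e"] norm r n by simp
  moreover have "norm (f (x - r *\<^sub>R e) - f x + f' (r *\<^sub>R e)) \<le> 1/4 * r"
    using d[of "x - r *\<^sub>R e"] norm r n by (simp add: f'.neg)
  ultimately show False
    using r unfolding second_difference_def real_norm_def by linarith
qed

lemma open_kinks:
  fixes f :: "real^'n \<Rightarrow> real"
  assumes "1-lipschitz_on (cbox 0 1) f"
  shows "open (kinks e n f)"
proof -
  have cont: "continuous_on (box 0 1) f"
    by (rule continuous_on_subset[OF lipschitz_on_continuous_on[OF assms] box_subset_cbox])
  define V where "V r = box 0 1 \<inter> (\<lambda>x. x + r *\<^sub>R e) -` box 0 1 \<inter> (\<lambda>x. x - r *\<^sub>R e) -` box 0 1" for r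
  have "open (V r)" for r
    unfolding V_def by (intro open_Int open_vimage open_box continuous_intros)
  moreover have "continuous_on (V r) (second_difference f (r *\<^sub>R e))" for r
    unfolding second_difference_def
    by (intro continuous_intros continuous_on_compose2[OF cont]) (auto simp: V_def)
  ultimately have "open (second_difference f (r *\<^sub>R e) -` {..<- r} \<inter> V r)" for r
    by (metis continuous_on_open_vimage open_lessThan)
  moreover have "kinks e n f =
      (\<Union>r\<in>{0<..<inverse (real (Suc n))}. second_difference f (r *\<^sub>R e) -` {..<- r} \<inter> V r)"
    unfolding kinks_def V_def by auto
  ultimately show ?thesis
    by auto
qed

lemma abs_diff_le_mdist_Lip1:
  fixes f g :: "real^'n \<Rightarrow> real"
  assumes "f \<in> mspace Lip1" "g \<in> mspace Lip1" "x \<in> cbox 0 1"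
  shows "\<bar>f x - g x\<bar> \<le> mdist Lip1 f g"
proof -
  have "1-lipschitz_on (cbox 0 1) f" "1-lipschitz_on (cbox 0 1) g"
    using assms by (auto simp: mspace_Lip1)
  then have "continuous_on (cbox 0 1) (\<lambda>x. \<bar>f x - g x\<bar>)"
    by (intro continuous_intros lipschitz_on_continuous_on)
  then have "bdd_above ((\<lambda>x. \<bar>f x - g x\<bar>) ` cbox 0 1)"
    by (intro bounded_imp_bdd_above compact_imp_bounded compact_continuous_image compact_cbox)
  then show ?thesis
    unfolding mdist_Lip1[OF assms(1,2)] using assms(3) by (intro cSUP_upper)
qed

lemma mdist_Lip1_le:
  fixes f g :: "real^'n \<Rightarrow> real"
  assumes "f \<in> mspace Lip1" "g \<in> mspace Lip1"
    and "\<And>x. x \<in> cbox 0 1 \<Longrightarrow> \<bar>f x - g x\<bar> \<le> c"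
  shows "mdist Lip1 f g \<le> c"
  unfolding mdist_Lip1[OF assms(1,2)]
  by (rule cSUP_least) (use assms(3) in \<open>auto simp: interval_ne_empty_cart\<close>)

lemma continuous_map_eval_Lip1:
  fixes x :: "real^'n"
  assumes "x \<in> cbox 0 1"
  shows "continuous_map (mtopology_of Lip1) euclideanreal (\<lambda>f. f x)"
proof -
  have "Lipschitz_continuous_map Lip1 euclidean_metric (\<lambda>f. f x)"
    unfolding Lipschitz_continuous_map_def
    using abs_diff_le_mdist_Lip1[OF _ _ assms]
    by (auto simp: dist_real_def intro!: exI[of _ 1])
  then show ?thesis
    using Lipschitz_continuous_imp_continuous_map by fastforce
qed

lemma openin_Lip1_kinks:
  fixes q :: "real^'n"
  shows "openin (mtopology_of Lip1) {f \<in> mspace Lip1. q \<in> kinks e n f}"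
proof -
  define R where "R = {r. q \<in> box 0 1 \<and> 0 < r \<and> r < inverse (real (Suc n)) \<and>
     q + r *\<^sub>R e \<in> box 0 1 \<and> q - r *\<^sub>R e \<in> box 0 1}"
  let ?U = "\<lambda>r. {f \<in> topspace (mtopology_of Lip1). second_difference f (r *\<^sub>R e) q \<in> {..<- r}}"
  have "openin (mtopology_of Lip1) (?U r)" if "r \<in> R" for r
  proof (rule openin_continuous_map_preimage)
    have "q \<in> cbox 0 1" "q + r *\<^sub>R e \<in> cbox 0 1" "q - r *\<^sub>R e \<in> cbox 0 1"
      using that box_subset_cbox[of 0 "1::real^'n"] unfolding R_def by blast+
    then show "continuous_map (mtopology_of Lip1) euclideanreal
        (\<lambda>f. second_difference f (r *\<^sub>R e) q)"
      unfolding second_difference_def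
      by (intro continuous_intros continuous_map_eval_Lip1)
  qed auto
  moreover have "{f \<in> mspace Lip1. q \<in> kinks e n f} = \<Union>(?U ` R)"
    unfolding kinks_def R_def by auto
  ultimately show ?thesis
    by auto
qed

text \<open>
  Planting a cone: after lowering \<open>f\<close> by \<open>\<delta>\<close>, the downward cone with apex \<open>(q, f q)\<close> sticks out
  of the graph near \<open>q\<close>, yet it never rises above \<open>f\<close> itself. Since the cone has slope exactly
  \<open>1\<close>, its kink has a size that does not depend on \<open>\<delta>\<close>.
\<close>

lemma kinks_dense:
  fixes f :: "real^'n \<Rightarrow> real"
  assumes "norm e = 1" and q: "q \<in> box 0 1" and f: "f \<in> mspace Lip1" and "\<delta> > 0"
  obtains g where "g \<in> mspace Lip1" "mdist Lip1 f g \<le> \<delta>" "q \<in> kinks e n g"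
proof -
  define h where "h x = max (f x - \<delta>) (f q - norm (x - q))" for x
  define g where "g = restrict h (cbox 0 1)"
  have qc: "q \<in> cbox 0 1"
    using q box_subset_cbox by blast
  have "1-lipschitz_on (cbox 0 1) f"
    using f by (simp add: mspace_Lip1)
  then have lip: "\<bar>f x - f y\<bar> \<le> norm (x - y)" if "x \<in> cbox 0 1" "y \<in> cbox 0 1" for x y
    using lipschitz_onD[of 1 _ f x y] that by (simp add: dist_norm)
  have "\<bar>h x - h y\<bar> \<le> norm (x - y)" if "x \<in> cbox 0 1" "y \<in> cbox 0 1" for x y
    using lip[OF that] norm_triangle_ineq3[of "x - q" "y - q"] unfolding h_def by simp
  then have g: "g \<in> mspace Lip1"
    unfolding mspace_Lip1 g_def by (auto simp: lipschitz_on_def dist_norm)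
  have "\<bar>f x - g x\<bar> \<le> \<delta>" if "x \<in> cbox 0 1" for x
    using lip[OF qc that] that \<open>\<delta> > 0\<close> unfolding g_def h_def by (auto simp: norm_minus_commute)
  then have dist: "mdist Lip1 f g \<le> \<delta>"
    by (rule mdist_Lip1_le[OF f g])
  obtain d where "d > 0" and d: "ball q d \<subseteq> box 0 1"
    using q open_box open_contains_ball by blast
  define r where "r = min (min (d / 2) (\<delta> / 2)) (inverse (real (Suc n)) / 2)"
  have "r \<le> d / 2" "r \<le> \<delta> / 2" "r \<le> inverse (real (Suc n)) / 2"
    unfolding r_def by linarith+
  moreover have "inverse (real (Suc n)) > 0"
    by simp
  ultimately have r: "0 < r" "r < d" "r \<le> \<delta> / 2" "r < inverse (real (Suc n))"
    using \<open>d > 0\<close> \<open>\<delta> > 0\<close> unfolding r_def by linarith+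
  have norm: "norm (r *\<^sub>R e) = r"
    using r \<open>norm e = 1\<close> by simp
  have inb: "q + r *\<^sub>R e \<in> box 0 1" "q - r *\<^sub>R e \<in> box 0 1"
    using d r norm by (auto simp: subset_iff dist_norm)
  then have inc: "q + r *\<^sub>R e \<in> cbox 0 1" "q - r *\<^sub>R e \<in> cbox 0 1"
    using box_subset_cbox by blast+
  \<comment> \<open>On the ball of radius \<open>\<delta> / 2\<close> around \<open>q\<close> the maximum is attained by the cone.\<close>
  have "g (q + r *\<^sub>R e) = f q - r" "g (q - r *\<^sub>R e) = f q - r"
    using lip[OF inc(1) qc] lip[OF inc(2) qc] inc r norm unfolding g_def h_def by auto
  moreover have "g q = f q"
    using qc \<open>\<delta> > 0\<close> unfolding g_def h_def by simp
  ultimately have "second_difference g (r *\<^sub>R e) q < - r"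
    using r unfolding second_difference_def by simp
  then have "q \<in> kinks e n g"
    unfolding kinks_def using q r inb by blast
  with g dist show ?thesis
    by (rule that)
qed

lemma closure_of_Lip1_kinks:
  fixes q :: "real^'n"
  assumes "norm e = 1" "q \<in> box 0 1"
  shows "mtopology_of Lip1 closure_of {f \<in> mspace Lip1. q \<in> kinks e n f}
    = topspace (mtopology_of Lip1)" (is "_ closure_of ?A = _")
proof -
  interpret L: Metric_space "mspace (Lip1 :: (real^'n \<Rightarrow> real) metric)" "mdist Lip1"
    by (rule Metric_space_mspace_mdist)
  have "\<exists>g\<in>?A. g \<in> L.mball f \<epsilon>" if f: "f \<in> mspace Lip1" and "\<epsilon> > 0" for f \<epsilon>
  proof -
    have "\<epsilon> / 2 > 0"
      using that by simp
    then obtain g where "g \<in> mspace Lip1" "mdist Lip1 f g \<le> \<epsilon> / 2" "q \<in> kinks e n g"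
      using kinks_dense[OF assms f] by blast
    then show ?thesis
      using f \<open>\<epsilon> > 0\<close> by (intro bexI[of _ g]) auto
  qed
  then show ?thesis
    unfolding mtopology_of_def L.metric_closure_of by auto
qed

theorem corollary1p2:
  fixes S :: "(real^'n) set"
  assumes "S \<subseteq> box 0 1"
  shows "\<exists>\<F>. residual_in (mtopology_of (Lip1 :: (real^'n \<Rightarrow> real) metric)) \<F> \<and>
           (\<forall>f\<in>\<F>. residual_in (top_of_set S) {x\<in>S. \<not> f differentiable (at x)})"
proof -
  define e :: "real^'n" where "e = axis undefined 1"
  have e: "norm e = 1"
    unfolding e_def by simp
  obtain D where D: "countable D" "D \<subseteq> S" "S \<subseteq> closure D"
    by (rule separable)
  define \<F> where "\<F> = {f \<in> mspace Lip1. \<forall>q\<in>D. \<forall>n. q \<in> kinks e n f}"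
  have "residual_in (mtopology_of Lip1) \<F>"
  proof (rule residual_in_if_contains_Inter_open_dense
      [where I = "D \<times> UNIV" and U = "\<lambda>(q, n). {f \<in> mspace Lip1. q \<in> kinks e n f}"])
    show "countable (D \<times> (UNIV :: nat set))"
      using D by blast
  next
    fix i :: "(real^'n) \<times> nat"
    assume "i \<in> D \<times> UNIV"
    then show "openin (mtopology_of Lip1) (case i of (q, n) \<Rightarrow> {f \<in> mspace Lip1. q \<in> kinks e n f})"
      by (auto simp: openin_Lip1_kinks)
    show "mtopology_of Lip1 closure_of (case i of (q, n) \<Rightarrow> {f \<in> mspace Lip1. q \<in> kinks e n f})
        = topspace (mtopology_of Lip1)"
      using \<open>i \<in> D \<times> UNIV\<close> D assms closure_of_Lip1_kinks[OF e] by (auto split: prod.splits)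
  qed (auto simp: \<F>_def)
  moreover have "residual_in (top_of_set S) {x\<in>S. \<not> f differentiable (at x)}" if "f \<in> \<F>" for f
  proof (rule residual_in_if_contains_Inter_open_dense
      [where I = "UNIV :: nat set" and U = "\<lambda>n. S \<inter> kinks e n f"])
    fix n
    have "open (kinks e n f)"
      using that by (intro open_kinks) (auto simp: \<F>_def mspace_Lip1)
    then show "openin (top_of_set S) (S \<inter> kinks e n f)"
      by (rule openin_open_Int)
    have "D \<subseteq> S \<inter> kinks e n f"
      using that D by (auto simp: \<F>_def)
    then have "S \<subseteq> closure (S \<inter> kinks e n f)"
      using D closure_mono by blast
    then show "top_of_set S closure_of (S \<inter> kinks e n f) = topspace (top_of_set S)"
      by (auto simp: closure_of_subtopology)
  qed (use not_differentiable_if_kinks[OF e] in auto)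
  ultimately show ?thesis
    by blast
qed

end
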